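(* Let $B=(V,E)$ be a Bratteli diagram with incidence matrices $F_n=(f^{(n)}_{v,w})$. Let $\overline B$ be a proper vertex subdiagram of $B$ defined by a sequence of subsets $W_n\subset V_n$, put $W'_n=V_n\setminus W_n$, and suppose that there is a constant $C>0$ such that $$\frac{|W_n|}{|V_n\setminus W_n|}\le C\quad\text{for every } n\geq 1 .$$ Suppose $\widehat\mu$ is a finite invariant measure on the path space $X_B$ which is obtained as the extension of a probability measure $\mu$ defined on $X_{\overline B}$ and invariant with respect to the tail equivalence relation of $\overline B$. Then $$\lim_{n\to\infty}\frac{\min_{v\in W'_n}\widehat\mu(X_v^{(n)})}{\max_{w\in W_n}\mu(\overline X_w^{(n)})}=0 .$$
   Context: Bratteli diagrams. A Bratteli diagram is an infinite graph $B=(V,E)$ with $V=\bigsqcup_{i\ge 0}V_i$, $E=\bigsqcup_{i\ge1}E_i$, where $V_0=\{v_0\}$ is a single point, all $V_i,E_i$ are finite, and there are a range map $r$ and a source map $s$ from $E$ to $V$ with $r(E_i)=V_i$, $s(E_i)=V_{i-1}$, $s^{-1}(v)\ne\emptyset$ for all $v\in V$ and $r^{-1}(v')\neq\emptyset$ for all $v'\in V\setminus V_0$. Multiple edges are allowed. The $n$-th incidence matrix $F_n=(f^{(n)}_{v,w})$ is the $|V_{n+1}|\times|V_n|$ matrix with $f^{(n)}_{v,w}=|\{e\in E_{n+1}: r(e)=v,\ s(e)=w\}|$, $v\in V_{n+1}$, $w\in V_n$. The path space $X_B$ is the set of infinite paths $x=(x_1,x_2,\dots)$, $x_i\in E_i$,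 $r(x_i)=s(x_{i+1})$, with the topology generated by cylinder sets of finite paths starting at $v_0$; it is assumed that $X_B$ is a Cantor set. Two paths $x=(x_n),y=(y_n)$ are tail equivalent (relation $\mathcal E$) if $x_n=y_n$ for all sufficiently large $n$. A Borel measure is $\mathcal E$-invariant (or simply invariant) if, for any two finite paths $s,s'$ from $v_0$ to the same vertex, the map replacing the initial segment $s$ by $s'$ preserves the measure. Subdiagrams. Let $W_0=V_0$ and, for $n>0$, let $W_n$ be a proper non-empty subset of $V_n$. The vertex subdiagram $\overline B=(\overline W,\overline E)$ has vertices $\overline W=\bigcup_n W_n$ and edges all $e\in E$ with both source and range in $\overline W$; it is assumed to be itself a Bratteli diagram. $X_{\overline B}\subset X_B$ is the set of infinite paths all of whose edges belong to $\overline B$, and $\widehat X_{\overline B}$ is the set of all paths in $X_B$ tail equivalent to some path in $X_{\overline B}$. Towers. For $v\in V_n$, $X_v^{(n)}\subset X_B$ is the set of all paths in $X_B$ that go through $v$; for $w\in W_n$, $\overline X_w^{(n)}\subset X_{\overline B}$ is the set of all paths in $X_{\overline B}$ that go through $w$. Measure extension. Given a probability measure $\mu$ on $X_{\overline B}$ invariant under the tail equivalence relation of $\overline B$, $\widehat\mu$ is the unique $\mathcal E$-invariant Borel measure on $\widehat X_{\overline B}$ whose restriction to $X_{\overline B}$ is $\mu$; it may be finite or infinite. It is regarded as a measure on all of $X_B$ by setting $\widehat\mu(X_B\setminus\widehat X_{\overline B})=0$. *)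

theory Defs
  imports "HOL-Probability.Probability"
begin

text \<open>Level \<open>n\<close> of \<open>Edges\<close> consists of the edges from \<open>Verts n\<close> to \<open>Verts (Suc n)\<close>, i.e. it is
  the set usually written $E_{n+1}$. Edges are objects of their own, so multiple edges are
  allowed.\<close>

record ('v, 'e) bratteli =
  Verts :: "nat \<Rightarrow> 'v set"
  Edges :: "nat \<Rightarrow> 'e set"
  src :: "'e \<Rightarrow> 'v"
  rng :: "'e \<Rightarrow> 'v"

text \<open>The two image conditions contain the requirements that every vertex emits an edge and that
  every vertex outside level 0 receives one. That the path space is a Cantor set is the separate
  predicate \<open>cantor_path_space\<close> below.\<close>

locale bratteli_diagram =
  fixes B :: "('v, 'e) bratteli"
  assumes root: "\<exists>v0. Verts B 0 = {v0}"
    and finite_Verts: "finite (Verts B n)"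
    and finite_Edges: "finite (Edges B n)"
    and disjoint_Verts: "disjoint_family (Verts B)"
    and disjoint_Edges: "disjoint_family (Edges B)"
    and src_Edges: "src B ` Edges B n = Verts B n"
    and rng_Edges: "rng B ` Edges B n = Verts B (Suc n)"

definition path_space :: "('v, 'e) bratteli \<Rightarrow> (nat \<Rightarrow> 'e) set" where
  "path_space B = {x. \<forall>n. x n \<in> Edges B n \<and> rng B (x n) = src B (x (Suc n))}"

text \<open>Finite paths of positive length from the root to \<open>v\<close>. As the vertex levels are disjoint, \<open>v\<close>
  determines the length.\<close>

definition finite_paths_to :: "('v, 'e) bratteli \<Rightarrow> 'v \<Rightarrow> 'e list set" where
  "finite_paths_to B v = {p. p \<noteq> [] \<and> (\<forall>i<length p. p ! i \<in> Edges B i) \<and>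
     (\<forall>i. Suc i < length p \<longrightarrow> rng B (p ! i) = src B (p ! Suc i)) \<and> rng B (last p) = v}"

definition cylinder :: "('v, 'e) bratteli \<Rightarrow> 'e list \<Rightarrow> (nat \<Rightarrow> 'e) set" where
  "cylinder B p = {x \<in> path_space B. \<forall>i<length p. x i = p ! i}"

definition path_topology :: "('v, 'e) bratteli \<Rightarrow> (nat \<Rightarrow> 'e) topology" where
  "path_topology B = topology_generated_by {cylinder B p | p v. p \<in> finite_paths_to B v}"

definition cantor_path_space :: "('v, 'e) bratteli \<Rightarrow> bool" where
  "cantor_path_space B \<longleftrightarrow> path_topology B homeomorphic_space
     product_topology (\<lambda>_::nat. discrete_topology (UNIV :: bool set)) UNIV"

definition path_borel :: "('v, 'e) bratteli \<Rightarrow> (nat \<Rightarrow> 'e) measure" where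
  "path_borel B = sigma (path_space B) {U. openin (path_topology B) U}"

definition tail_equiv :: "(nat \<Rightarrow> 'e) \<Rightarrow> (nat \<Rightarrow> 'e) \<Rightarrow> bool" where
  "tail_equiv x y \<longleftrightarrow> (\<exists>N. \<forall>n\<ge>N. x n = y n)"

definition replace_initial :: "'e list \<Rightarrow> (nat \<Rightarrow> 'e) \<Rightarrow> (nat \<Rightarrow> 'e)" where
  "replace_initial q x = (\<lambda>i. if i < length q then q ! i else x i)"

definition invariant_measure :: "('v, 'e) bratteli \<Rightarrow> (nat \<Rightarrow> 'e) measure \<Rightarrow> bool" where
  "invariant_measure B M \<longleftrightarrow> sets M = sets (path_borel B) \<and>
     (\<forall>v. \<forall>p\<in>finite_paths_to B v. \<forall>q\<in>finite_paths_to B v. \<forall>A\<in>sets M.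
        A \<subseteq> cylinder B p \<longrightarrow> emeasure M (replace_initial q ` A) = emeasure M A)"

definition vertex_restrict :: "('v, 'e) bratteli \<Rightarrow> (nat \<Rightarrow> 'v set) \<Rightarrow> ('v, 'e) bratteli" where
  "vertex_restrict B W =
     \<lparr>Verts = W, Edges = (\<lambda>n. {e \<in> Edges B n. src B e \<in> W n \<and> rng B e \<in> W (Suc n)}),
      src = src B, rng = rng B\<rparr>"

definition proper_vertex_subdiagram :: "('v, 'e) bratteli \<Rightarrow> (nat \<Rightarrow> 'v set) \<Rightarrow> bool" where
  "proper_vertex_subdiagram B W \<longleftrightarrow> W 0 = Verts B 0 \<and>
     (\<forall>n>0. W n \<noteq> {} \<and> W n \<subset> Verts B n) \<and> bratteli_diagram (vertex_restrict B W)"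

definition saturation :: "('v, 'e) bratteli \<Rightarrow> (nat \<Rightarrow> 'v set) \<Rightarrow> (nat \<Rightarrow> 'e) set" where
  "saturation B W = {x \<in> path_space B. \<exists>y\<in>path_space (vertex_restrict B W). tail_equiv x y}"

text \<open>The paths through the vertex \<open>v\<close> of level \<open>n\<close>.\<close>

definition tower :: "('v, 'e) bratteli \<Rightarrow> nat \<Rightarrow> 'v \<Rightarrow> (nat \<Rightarrow> 'e) set" where
  "tower B n v = {x \<in> path_space B. src B (x n) = v}"

text \<open>The conditions on \<open>N\<close> determine it uniquely: the saturation is covered by the countably many
  sets of paths that follow a finite path of \<open>B\<close> to a vertex of \<open>W\<close> and then stay in the
  subdiagram, and invariance carries the mass of each from a subset of the path space of the
  subdiagram. \<open>N\<close> may be infinite.\<close>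

definition measure_extension ::
  "('v, 'e) bratteli \<Rightarrow> (nat \<Rightarrow> 'v set) \<Rightarrow> (nat \<Rightarrow> 'e) measure \<Rightarrow> (nat \<Rightarrow> 'e) measure \<Rightarrow> bool" where
  "measure_extension B W M N \<longleftrightarrow> invariant_measure B N \<and>
     restrict_space N (path_space (vertex_restrict B W)) = M \<and>
     path_space B - saturation B W \<in> null_sets N"

end

theory Submission imports Defs begin

text \<open>Let \<open>m n\<close> be the \<open>\<mu>hat\<close>-mass of the paths that are outside \<open>W n\<close> at level \<open>n\<close>. A path of
  the saturation agrees with a path of the subdiagram from some level on, so almost every path
  is outside \<open>W n\<close> for only finitely many \<open>n\<close>. As \<open>\<mu>hat\<close> is finite, dominated convergence gives
  \<open>m n \<longlonglongrightarrow> 0\<close> (lemma \<open>mass_off_subdiagram_tendsto_0\<close>).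

  The rest is pigeonhole, for \<open>n \<ge> 1\<close>. The towers over \<open>Verts B n - W n\<close> partition a set of mass \<open>m n\<close>, so the
  smallest has mass at most \<open>m n / card (Verts B n - W n)\<close>. The towers over \<open>W n\<close> in the
  subdiagram partition a set of mass 1, so the largest has mass at least \<open>1 / card (W n)\<close>. The
  quotient is therefore at most \<open>C * m n\<close>.\<close>

lemma space_path_borel [simp]: "space (path_borel B) = path_space B"
  by (simp add: path_borel_def space_measure_of_conv)

lemma openin_path_topology_subset:
  assumes "openin (path_topology B) U"
  shows "U \<subseteq> path_space B"
proof -
  have "U \<subseteq> topspace (path_topology B)"
    using assms by (rule openin_subset)
  also have "\<dots> \<subseteq> path_space B"
    by (auto simp: path_topology_def cylinder_def)
  finally show ?thesis .
qed

lemma openin_imp_sets_path_borel: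
  assumes "openin (path_topology B) U"
  shows "U \<in> sets (path_borel B)"
proof -
  have "{U. openin (path_topology B) U} \<subseteq> Pow (path_space B)"
    using openin_path_topology_subset by blast
  then show ?thesis
    using assms by (auto simp: path_borel_def sets_measure_of)
qed

text \<open>The vertex at level \<open>n\<close> is read off from the first \<open>n + 1\<close> edges, so a tower contains with
  each path the cylinder around its initial segment of that length.\<close>

lemma openin_tower:
  fixes B :: "('v, 'e) bratteli"
  shows "openin (path_topology B) (tower B n v)"
proof -
  define pre where "pre x = map x [0..<Suc n]" for x :: "nat \<Rightarrow> 'e"
  have len: "length (pre x) = Suc n" for x
    by (simp add: pre_def)
  have nth: "pre x ! i = x i" if "i < Suc n" for x i
    using that unfolding pre_def by (subst nth_map) (simp_all del: upt_Suc)
  have path: "pre x \<in> finite_paths_to B (rng B (x n))" if "x \<in> path_space B" for x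
  proof -
    have "last (pre x) = x n"
      by (simp add: pre_def)
    moreover have "pre x \<noteq> []"
      by (simp add: pre_def)
    ultimately show ?thesis
      using that by (auto simp: finite_paths_to_def path_space_def len nth)
  qed
  have "tower B n v = \<Union> ((\<lambda>x. cylinder B (pre x)) ` tower B n v)"
    by (auto simp: tower_def cylinder_def len nth)
  moreover have "openin (path_topology B) (cylinder B (pre x))" if "x \<in> tower B n v" for x
    unfolding path_topology_def
    by (rule topology_generated_by_Basis) (use that path in \<open>auto simp: tower_def\<close>)
  ultimately show ?thesis
    by (metis (no_types, lifting) imageE openin_Union)
qed

lemma sets_tower: "tower B n v \<in> sets (path_borel B)"
  by (intro openin_imp_sets_path_borel openin_tower)

lemma disjoint_family_on_tower: "disjoint_family_on (tower B n) S"
  by (auto simp: disjoint_family_on_def tower_def)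

lemma src_in_Verts:
  assumes "bratteli_diagram B" and "x \<in> path_space B"
  shows "src B (x n) \<in> Verts B n"
  using assms bratteli_diagram.src_Edges[of B n] by (auto simp: path_space_def)

lemma measure_Union_tower:
  assumes "finite_measure M" and "sets M = sets (path_borel B)" and "finite S"
  shows "measure M (\<Union>v\<in>S. tower B n v) = (\<Sum>v\<in>S. measure M (tower B n v))"
  using assms sets_tower
  by (intro finite_measure.finite_measure_finite_Union disjoint_family_on_tower) auto

lemma saturation_eventually_in_subdiagram:
  assumes "x \<in> saturation B W"
  shows "\<forall>\<^sub>F n in sequentially. src B (x n) \<in> W n"
proof -
  obtain y N where y: "y \<in> path_space (vertex_restrict B W)" and N: "\<And>n. n \<ge> N \<Longrightarrow> x n = y n"
    using assms by (auto simp: saturation_def tail_equiv_def)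
  have "src B (y n) \<in> W n" for n
    using y by (auto simp: path_space_def vertex_restrict_def)
  then show ?thesis
    using N unfolding eventually_sequentially by metis
qed

lemma mass_off_subdiagram_tendsto_0:
  assumes B: "bratteli_diagram B" and "finite_measure N"
    and N: "sets N = sets (path_borel B)" "path_space B - saturation B W \<in> null_sets N"
  shows "(\<lambda>n. \<Sum>v\<in>Verts B n - W n. measure N (tower B n v)) \<longlonglongrightarrow> 0"
proof -
  interpret N: finite_measure N by fact
  define A where "A n = (\<Union>v\<in>Verts B n - W n. tower B n v)" for n
  have fin: "finite (Verts B n - W n)" for n
    using B by (simp add: bratteli_diagram.finite_Verts)
  have A: "A n \<in> sets N" for n
    unfolding A_def using fin sets_tower N(1) by (intro sets.finite_UN) auto
  have "AE x in N. (\<lambda>n. indicator (A n) x :: real) \<longlonglongrightarrow> 0"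
  proof (rule AE_I')
    show "{x \<in> space N. \<not> (\<lambda>n. indicator (A n) x :: real) \<longlonglongrightarrow> 0} \<subseteq> path_space B - saturation B W"
    proof clarify
      fix x assume x: "x \<in> space N" and lim: "\<not> (\<lambda>n. indicator (A n) x :: real) \<longlonglongrightarrow> 0"
      have "x \<notin> saturation B W"
      proof
        assume "x \<in> saturation B W"
        then have "\<forall>\<^sub>F n in sequentially. indicator (A n) x = (0 :: real)"
          by (rule eventually_mono[OF saturation_eventually_in_subdiagram])
             (auto simp: A_def tower_def indicator_def)
        then show False
          using lim by (simp add: tendsto_eventually)
      qed
      then show "x \<in> path_space B - saturation B W"
        using x sets_eq_imp_space_eq[OF N(1)] by simp
    qed
  qed (rule N(2))
  then have "(\<lambda>n. \<integral>x. indicator (A n) x \<partial>N) \<longlonglongrightarrow> (\<integral>x. (0 :: real) \<partial>N)"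
    using A by (intro integral_dominated_convergence[where w = "\<lambda>_. 1"])
               (auto simp: indicator_def)
  then have "(\<lambda>n. measure N (A n)) \<longlonglongrightarrow> 0"
    using A by (simp add: sets.Int_space_eq2)
  then show ?thesis
    by (simp add: A_def measure_Union_tower[OF assms(2) N(1) fin])
qed

lemma card_mult_Min_le_sum:
  fixes f :: "'a \<Rightarrow> real"
  assumes "finite S"
  shows "real (card S) * Min (f ` S) \<le> sum f S"
  using sum_bounded_below[of S "Min (f ` S)" f] assms by simp

lemma sum_le_card_mult_Max:
  fixes f :: "'a \<Rightarrow> real"
  assumes "finite S"
  shows "sum f S \<le> real (card S) * Max (f ` S)"
  using sum_bounded_above[of S f "Max (f ` S)"] assms by simp

theorem proposition2p7:
  fixes B :: "('v, 'e) bratteli" and W :: "nat \<Rightarrow> 'v set" and C :: real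
    and \<mu> \<mu>hat :: "(nat \<Rightarrow> 'e) measure"
  assumes "bratteli_diagram B" and "cantor_path_space B"
    and "proper_vertex_subdiagram B W"
    and "C > 0"
    and "\<And>n. n \<ge> 1 \<Longrightarrow> real (card (W n)) / real (card (Verts B n - W n)) \<le> C"
    and "prob_space \<mu>" and "invariant_measure (vertex_restrict B W) \<mu>"
    and "measure_extension B W \<mu> \<mu>hat" and "finite_measure \<mu>hat"
  shows "(\<lambda>n. Min ((\<lambda>v. measure \<mu>hat (tower B n v)) ` (Verts B n - W n)) /
              Max ((\<lambda>w. measure \<mu> (tower (vertex_restrict B W) n w)) ` W n)) \<longlonglongrightarrow> 0"
proof -
  let ?S = "vertex_restrict B W"
  define m where "m n = (\<Sum>v\<in>Verts B n - W n. measure \<mu>hat (tower B n v))" for n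
  define a where "a n = Min ((\<lambda>v. measure \<mu>hat (tower B n v)) ` (Verts B n - W n))" for n
  define b where "b n = Max ((\<lambda>w. measure \<mu> (tower ?S n w)) ` W n)" for n
  interpret \<mu>: prob_space \<mu> by fact
  have S: "bratteli_diagram ?S" and W: "\<And>n. n > 0 \<Longrightarrow> W n \<noteq> {} \<and> W n \<subset> Verts B n"
    using assms(3) by (auto simp: proper_vertex_subdiagram_def)
  have Verts_S: "Verts ?S n = W n" for n
    by (simp add: vertex_restrict_def)
  have finV: "finite (Verts B n)" and finW: "finite (W n)" for n
    using bratteli_diagram.finite_Verts[OF assms(1)] bratteli_diagram.finite_Verts[OF S]
    by (simp_all add: Verts_S)
  have \<mu>: "sets \<mu> = sets (path_borel ?S)"
    using assms(7) by (simp add: invariant_measure_def)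
  have m: "m \<longlonglongrightarrow> 0"
    using mass_off_subdiagram_tendsto_0[OF assms(1,9)] assms(8)
    by (simp add: m_def [abs_def] measure_extension_def invariant_measure_def)
  have total: "(\<Sum>w\<in>W n. measure \<mu> (tower ?S n w)) = 1" for n
  proof -
    have "(\<Union>w\<in>W n. tower ?S n w) = space \<mu>"
      using src_in_Verts[OF S] by (auto simp: sets_eq_imp_space_eq[OF \<mu>] tower_def Verts_S)
    then show ?thesis
      using measure_Union_tower[OF \<mu>.finite_measure_axioms \<mu> finW, of n n] by (simp add: \<mu>.prob_space)
  qed
  have bounds: "0 \<le> a n / b n" "a n / b n \<le> C * m n" if "n > 0" for n
  proof -
    define w w' where "w = real (card (W n))" and "w' = real (card (Verts B n - W n))"
    have pos: "w > 0" "w' > 0"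
      using W[OF that] finV[of n] finW[of n] by (auto simp: w_def w'_def card_gt_0_iff)
    have ratio: "w / w' \<le> C"
      using assms(5)[of n] that by (simp add: w_def w'_def)
    have a0: "0 \<le> a n"
      unfolding a_def using W[OF that] finV[of n] by (subst Min_ge_iff) auto
    have am: "w' * a n \<le> m n"
      unfolding w'_def a_def m_def using finV[of n] by (intro card_mult_Min_le_sum) auto
    have "1 \<le> w * b n"
      using sum_le_card_mult_Max[OF finW, of "\<lambda>w. measure \<mu> (tower ?S n w)" n] total[of n]
      by (simp add: w_def b_def)
    then have b: "1 / w \<le> b n"
      using pos by (simp add: field_simps)
    moreover have "0 < 1 / w"
      using pos by simp
    ultimately have b0: "b n > 0"
      by linarith
    show "0 \<le> a n / b n"
      using a0 b0 by simp
    have "a n / b n \<le> (m n / w') / (1 / w)"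
      using a0 am b pos order_trans[OF mult_nonneg_nonneg[of w' "a n"] am]
      by (intro frac_le) (auto simp: field_simps)
    also have "\<dots> = (w / w') * m n"
      by simp
    also have "\<dots> \<le> C * m n"
      using ratio by (intro mult_right_mono) (auto simp: m_def intro: sum_nonneg)
    finally show "a n / b n \<le> C * m n" .
  qed
  have "(\<lambda>n. a n / b n) \<longlonglongrightarrow> 0"
  proof (rule tendsto_sandwich[OF _ _ tendsto_const])
    show "(\<lambda>n. C * m n) \<longlonglongrightarrow> 0"
      using tendsto_mult_left[OF m, of C] by simp
  qed (use bounds in \<open>auto intro: eventually_mono[OF eventually_gt_at_top[of 0]]\<close>)
  then show ?thesis
    by (simp add: a_def b_def)
qed

end
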